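(* Let $\mathbb{F}_q$ be a finite field with $q$ elements, let $n\ge 1$, and let $\Phi\colon A^n\to A^n$ be the polynomial self-map of affine $n$-space given in coordinates by polynomials $f_1,\dots,f_n\in\mathbb{F}_q[x_1,\dots,x_n]$. Let $\Phi^n$ be the $n$-th iterate of $\Phi$ (the same $n$ as the dimension), and let $V$ be the Zariski closure of $\Phi^n(A^n)$ in $A^n$. Then: 1. All quasi-fixed points of $\Phi$ belong to $V$. 2. The quasi-fixed points of $\Phi$ are Zariski dense in $V$. In other words, if $W\subset V$ is a proper Zariski closed subvariety of $V$, then for some $Q=q^m$ there is a point $(a_1,\dots,a_n)\in V\setminus W$ such that $f_i(a_1,\dots,a_n)=a_i^Q$ for all $i=1,\dots,n$.
   Context: Let $\overline{\mathbb{F}}_q$ be an algebraic closure of $\mathbb{F}_q$. Points of $A^n$ are points with coordinates in $\overline{\mathbb{F}}_q$, and closures and subvarieties are taken in the Zariski topology of $A^n$ over $\overline{\mathbb{F}}_q$. A point $a=(a_1,\dots,a_n)\in A^n(\overline{\mathbb{F}}_q)$ is called quasi-fixed with respect to $\Phi$ if there is $Q=q^m$, with $m$ a positive integer, such that $f_i(a_1,\dots,a_n)=a_i^Q$ for all $i=1,\dots,n$. *)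

theory Defs
  imports
    "HOL-Library.Poly_Mapping"
    "HOL-Algebra.Algebraic_Closure_Type"
    "HOL-Analysis.Finite_Cartesian_Product"
    "HOL-Analysis.Abstract_Topology"
begin

text \<open>
  A polynomial in variables indexed by \<open>'n\<close> is a finitely supported map from
  monomials (finitely supported exponent vectors) to coefficients; addition and multiplication
  are those of \<open>HOL-Library.Poly_Mapping\<close>.
\<close>

type_synonym ('n, 'k) mpoly = "('n \<Rightarrow>\<^sub>0 nat) \<Rightarrow>\<^sub>0 'k"

definition mpoly_eval :: "('n::finite, 'k::comm_ring_1) mpoly \<Rightarrow> 'k ^ 'n \<Rightarrow> 'k" where
  "mpoly_eval p a =
     (\<Sum>m\<in>Poly_Mapping.keys p.
        Poly_Mapping.lookup p m * (\<Prod>i\<in>UNIV. (a $ i) ^ Poly_Mapping.lookup m i))"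

lemma mpoly_eval_superset:
  assumes "finite A" "Poly_Mapping.keys p \<subseteq> A"
  shows "mpoly_eval p a =
    (\<Sum>m\<in>A. Poly_Mapping.lookup p m * (\<Prod>i\<in>UNIV. (a $ i) ^ Poly_Mapping.lookup m i))"
  unfolding mpoly_eval_def
  by (rule sum.mono_neutral_left) (use assms in \<open>auto simp: in_keys_iff\<close>)

lemma mpoly_eval_add: "mpoly_eval (p + q) a = mpoly_eval p a + mpoly_eval q a"
proof -
  let ?A = "Poly_Mapping.keys p \<union> Poly_Mapping.keys q"
  have "Poly_Mapping.keys (p + q) \<subseteq> ?A"
    by (rule Poly_Mapping.keys_add)
  then show ?thesis
    by (simp add: mpoly_eval_superset[of ?A] lookup_add sum.distrib distrib_right)
qed

lemma mpoly_eval_0 [simp]: "mpoly_eval 0 a = 0"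
  by (simp add: mpoly_eval_def)

lemma mpoly_eval_single:
  "mpoly_eval (Poly_Mapping.single m c) a = c * (\<Prod>i\<in>UNIV. (a $ i) ^ Poly_Mapping.lookup m i)"
  by (simp add: mpoly_eval_def)

lemma mpoly_eval_1 [simp]: "mpoly_eval 1 a = 1"
  using mpoly_eval_single[of 0 1 a] by simp

lemma mpoly_eval_sum: "mpoly_eval (sum f A) a = (\<Sum>x\<in>A. mpoly_eval (f x) a)"
  by (induction A rule: infinite_finite_induct) (auto simp: mpoly_eval_add)

lemma mpoly_sum_single:
  fixes p :: "('n::finite, 'k::comm_ring_1) mpoly"
  shows "p = (\<Sum>m\<in>Poly_Mapping.keys p. Poly_Mapping.single m (Poly_Mapping.lookup p m))"
  by (rule poly_mapping_eqI)
     (auto simp: lookup_sum lookup_single when_def in_keys_iff)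

lemma mpoly_eval_mult: "mpoly_eval (p * q) a = mpoly_eval p a * mpoly_eval q a"
proof -
  have "p * q = (\<Sum>m\<in>Poly_Mapping.keys p. \<Sum>m'\<in>Poly_Mapping.keys q.
          Poly_Mapping.single (m + m') (Poly_Mapping.lookup p m * Poly_Mapping.lookup q m'))"
    by (subst mpoly_sum_single[of p], subst mpoly_sum_single[of q])
       (simp only: sum_product mult_single)
  then have "mpoly_eval (p * q) a = (\<Sum>m\<in>Poly_Mapping.keys p. \<Sum>m'\<in>Poly_Mapping.keys q.
      Poly_Mapping.lookup p m * Poly_Mapping.lookup q m' *
      (\<Prod>i\<in>UNIV. (a $ i) ^ Poly_Mapping.lookup (m + m') i))"
    by (simp only: mpoly_eval_sum mpoly_eval_single)
  also have "\<dots> = mpoly_eval p a * mpoly_eval q a"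
    by (simp add: mpoly_eval_def sum_product lookup_add power_add prod.distrib mult_ac)
  finally show ?thesis .
qed

definition zero_locus :: "('n::finite, 'k::field) mpoly set \<Rightarrow> ('k ^ 'n) set" where
  "zero_locus S = {a. \<forall>p\<in>S. mpoly_eval p a = 0}"

definition zariski :: "('k::field ^ 'n::finite) topology" where
  "zariski = topology (\<lambda>U. \<exists>S. U = - zero_locus S)"

lemma openin_zariski:
  fixes U :: "('k::field ^ 'n::finite) set"
  shows "openin zariski U \<longleftrightarrow> (\<exists>S. U = - zero_locus S)"
proof -
  have "istopology (\<lambda>U :: ('k::field ^ 'n::finite) set. \<exists>S. U = - zero_locus S)"
    unfolding istopology_def
  proof (intro conjI allI impI)
    fix U V :: "('k::field ^ 'n::finite) set"
    assume "\<exists>S. U = - zero_locus S" "\<exists>S. V = - zero_locus S"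
    then obtain S T where "U = - zero_locus S" "V = - zero_locus T"
      by blast
    then have "U \<inter> V = - zero_locus {p * q | p q. p \<in> S \<and> q \<in> T}"
      by (fastforce simp: zero_locus_def mpoly_eval_mult)
    then show "\<exists>R. U \<inter> V = - zero_locus R"
      by blast
  next
    fix \<K> :: "('k::field ^ 'n::finite) set set"
    assume "\<forall>K\<in>\<K>. \<exists>S. K = - zero_locus S"
    then obtain S where "\<forall>K\<in>\<K>. K = - zero_locus (S K)"
      by metis
    then have "\<Union>\<K> = - zero_locus (\<Union>(S ` \<K>))"
      by (fastforce simp: zero_locus_def)
    then show "\<exists>R. \<Union>\<K> = - zero_locus R"
      by blast
  qed
  then show ?thesis
    by (simp add: zariski_def)
qed

lemma topspace_zariski [simp]: "topspace zariski = UNIV"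
proof -
  have "openin zariski (- zero_locus {1} :: ('a::field ^ 'b::finite) set)"
    unfolding openin_zariski by blast
  moreover have "- zero_locus {1} = (UNIV :: ('a::field ^ 'b::finite) set)"
    by (simp add: zero_locus_def)
  ultimately show ?thesis
    using openin_subset by fastforce
qed

lemma closedin_zariski: "closedin zariski C \<longleftrightarrow> (\<exists>S. C = zero_locus S)"
  by (auto simp: closedin_def openin_zariski simp flip: Compl_eq_Diff_UNIV)

text \<open>
  The finite field \<open>\<F>\<^sub>q\<close> is the type \<open>'k\<close>, with \<open>q = CARD('k)\<close>; its algebraic closure is
  \<open>'k alg_closure\<close>, into which coefficients are mapped by \<^const>\<open>to_ac\<close>.
\<close>

definition poly_self_map ::
    "('n \<Rightarrow> ('n::finite, 'k::field) mpoly) \<Rightarrow> 'k alg_closure ^ 'n \<Rightarrow> 'k alg_closure ^ 'n" where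
  "poly_self_map f a = (\<chi> i. mpoly_eval (Poly_Mapping.map to_ac (f i)) a)"

definition quasi_fixed ::
    "('n \<Rightarrow> ('n::finite, 'k::{field,finite}) mpoly) \<Rightarrow> 'k alg_closure ^ 'n \<Rightarrow> bool" where
  "quasi_fixed f a \<longleftrightarrow> (\<exists>m>0. \<forall>i. poly_self_map f a $ i = (a $ i) ^ (CARD('k) ^ m))"

end

theory Submission
  imports Defs
begin

text \<open>
  Let \<open>I\<close> be the ideal generated by the polynomials \<open>f\<^sub>i - x\<^sub>i ^ Q\<close> over the algebraic closure;
  its zeros are the quasi-fixed points for \<open>Q\<close>. If \<open>D\<close> vanishes on all quasi-fixed points and \<open>Q\<close>
  is a power of \<open>q\<close> such that the coefficients of \<open>D\<close> lie in \<open>\<F>\<^sub>Q\<close>, then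
  \<open>D \<circ> \<Phi>\<^sup>j \<equiv> D ^ (Q ^ j)\<close> modulo \<open>I\<close>. The \<open>n + 1\<close> polynomials \<open>D \<circ> \<Phi>\<^sup>j\<close>, \<open>j \<le> n\<close>, in \<open>n\<close>
  variables satisfy an algebraic relation, which does not depend on \<open>Q\<close>. Modulo \<open>I\<close> it becomes a
  nontrivial univariate equation for \<open>D\<close> of degree at most \<open>K Q ^ n\<close>. By the Nullstellensatz \<open>D\<close> is
  nilpotent modulo \<open>I\<close>, so the equation forces \<open>D ^ (K Q ^ n) \<in> I\<close>, that is,
  \<open>(D \<circ> \<Phi>\<^sup>n) ^ K \<in> I\<close> with \<open>K\<close> independent of \<open>Q\<close>. As \<open>I\<close> contains no nonzero polynomial of
  degree less than \<open>Q\<close>, \<open>D\<close> vanishes on the image of \<open>\<Phi>\<^sup>n\<close>.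
\<close>

text \<open>A commutative ring as a module over itself: \<open>ring_ideal.subspace\<close> means
  being an ideal, and \<open>ring_ideal.span\<close> is the ideal generated by a set.\<close>

interpretation ring_ideal: Modules.module "(*) :: 'a::comm_ring_1 \<Rightarrow> 'a \<Rightarrow> 'a"
  by unfold_locales (simp_all add: algebra_simps)

text \<open>This instance of the module law reverses \<open>mult.assoc\<close> and would loop with it.\<close>
declare ring_ideal.scale_scale [simp del]

section \<open>Evaluation and substitution\<close>

abbreviation Const :: "'k::comm_ring_1 \<Rightarrow> ('n::finite, 'k) mpoly" where
  "Const c \<equiv> Poly_Mapping.single 0 c"

definition Var :: "'n \<Rightarrow> ('n::finite, 'k::comm_ring_1) mpoly" where
  "Var i = Poly_Mapping.single (Poly_Mapping.single i 1) 1"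

definition mpoly_subst ::
    "('n::finite, 'k::comm_ring_1) mpoly \<Rightarrow> ('n \<Rightarrow> ('l::finite, 'k) mpoly) \<Rightarrow> ('l, 'k) mpoly" where
  "mpoly_subst p G = (\<Sum>m\<in>Poly_Mapping.keys p.
     Const (Poly_Mapping.lookup p m) * (\<Prod>i\<in>UNIV. G i ^ Poly_Mapping.lookup m i))"

lemma mpoly_eval_Const [simp]: "mpoly_eval (Const c) a = c"
  by (simp add: mpoly_eval_single)

lemma mpoly_eval_Var [simp]: "mpoly_eval (Var i) a = a $ i"
proof -
  have "(\<Prod>j\<in>UNIV. a $ j ^ Poly_Mapping.lookup (Poly_Mapping.single i 1) j) =
      (\<Prod>j\<in>UNIV. if j = i then a $ j else 1)"
    by (rule prod.cong) (auto simp: lookup_single when_def)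
  then show ?thesis
    by (simp add: Var_def mpoly_eval_single)
qed

lemma mpoly_eval_diff: "mpoly_eval (p - q) a = mpoly_eval p a - mpoly_eval q a"
  using mpoly_eval_add[of "p - q" q a] by simp

lemma mpoly_eval_power: "mpoly_eval (p ^ k) a = mpoly_eval p a ^ k"
  by (induction k) (simp_all add: mpoly_eval_mult)

lemma mpoly_eval_prod: "mpoly_eval (prod g A) a = (\<Prod>x\<in>A. mpoly_eval (g x) a)"
  by (induction A rule: infinite_finite_induct) (auto simp: mpoly_eval_mult)

lemma mpoly_eval_subst:
  "mpoly_eval (mpoly_subst p G) a = mpoly_eval p (\<chi> i. mpoly_eval (G i) a)"
  by (simp add: mpoly_subst_def mpoly_eval_sum mpoly_eval_mult mpoly_eval_prod mpoly_eval_power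
      mpoly_eval_def[of p])

text \<open>Reduction modulo \<open>Q\<close> yields the lowest digits; cancelling them and dividing
  by \<open>Q\<close> leaves one digit fewer. Used for Kronecker substitution and again for the
  univariate equation modulo an ideal.\<close>

lemma digits_unique:
  fixes Q :: nat
  assumes "\<And>j. j < k \<Longrightarrow> \<alpha> j < Q" "\<And>j. j < k \<Longrightarrow> \<beta> j < Q"
    and "(\<Sum>j<k. \<alpha> j * Q ^ j) = (\<Sum>j<k. \<beta> j * Q ^ j)" and "j < k"
  shows "\<alpha> j = \<beta> j"
  using assms
proof (induction k arbitrary: \<alpha> \<beta> j)
  case (Suc k)
  have split: "(\<Sum>j<Suc k. \<gamma> j * Q ^ j) = \<gamma> 0 + Q * (\<Sum>j<k. \<gamma> (Suc j) * Q ^ j)" for \<gamma> :: "nat \<Rightarrow> nat"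
    by (subst sum.lessThan_Suc_shift) (simp add: sum_distrib_left mult_ac)
  have eq: "\<alpha> 0 + Q * (\<Sum>j<k. \<alpha> (Suc j) * Q ^ j) = \<beta> 0 + Q * (\<Sum>j<k. \<beta> (Suc j) * Q ^ j)"
    using Suc.prems(3) by (simp only: split)
  have less: "\<alpha> 0 < Q" "\<beta> 0 < Q"
    using Suc.prems by auto
  have "\<alpha> 0 = \<beta> 0"
    using arg_cong[OF eq, of "\<lambda>x. x mod Q"] less by simp
  moreover have "(\<Sum>j<k. \<alpha> (Suc j) * Q ^ j) = (\<Sum>j<k. \<beta> (Suc j) * Q ^ j)"
    using eq less \<open>\<alpha> 0 = \<beta> 0\<close> by auto
  then have "\<alpha> (Suc i) = \<beta> (Suc i)" if "i < k" for i
    using Suc.IH[of "\<lambda>j. \<alpha> (Suc j)" "\<lambda>j. \<beta> (Suc j)" i] Suc.prems(1,2) that by simp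
  ultimately show ?case
    using Suc.prems(4) by (cases j) auto
qed simp

text \<open>Kronecker substitution \<open>x\<^sub>i = t ^ B ^ e i\<close> reduces the claim to univariate polynomials.\<close>
lemma mpoly_eq_0I:
  fixes p :: "('n::finite, 'k::field) mpoly"
  assumes inf: "infinite (UNIV :: 'k set)" and zero: "\<And>a. mpoly_eval p a = 0"
  shows "p = 0"
proof (rule poly_mapping_eqI)
  fix m0 :: "'n \<Rightarrow>\<^sub>0 nat"
  let ?n = "CARD('n)"
  \<comment> \<open>\<open>m0\<close> need not occur in \<open>p\<close>; including it separates its
    weight from all others in that case too.\<close>
  let ?K = "insert m0 (Poly_Mapping.keys p)"
  obtain e :: "'n \<Rightarrow> nat" where e: "bij_betw e UNIV {..<?n}"
    using ex_bij_betw_finite_nat[of "UNIV :: 'n set"] by (auto simp: atLeast0LessThan)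
  \<comment> \<open>\<open>B\<close> exceeds all exponents involved, so they are the base
    \<open>B\<close> digits of \<open>w m\<close>, which determines \<open>m\<close>.\<close>
  define B where "B = Suc (\<Sum>m\<in>?K. \<Sum>i\<in>UNIV. Poly_Mapping.lookup m i)"
  define w where "w m = (\<Sum>i\<in>UNIV. Poly_Mapping.lookup m i * B ^ e i)" for m
  have bound: "Poly_Mapping.lookup m i < B" if "m \<in> ?K" for m i
  proof -
    have "Poly_Mapping.lookup m i \<le> (\<Sum>i\<in>UNIV. Poly_Mapping.lookup m i)"
      by (rule member_le_sum) auto
    also have "\<dots> \<le> (\<Sum>m\<in>?K. \<Sum>i\<in>UNIV. Poly_Mapping.lookup m i)"
      using that by (intro member_le_sum) auto
    finally show ?thesis by (simp add: B_def)
  qed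
  have w_inj: "m = m'" if "m \<in> ?K" "m' \<in> ?K" "w m = w m'" for m m'
  proof (rule poly_mapping_eqI)
    fix i
    have w_alt: "w m = (\<Sum>j<?n. Poly_Mapping.lookup m (inv_into UNIV e j) * B ^ j)" for m
      unfolding w_def using e
      by (subst sum.reindex_bij_betw[OF e, symmetric]) (simp add: bij_betw_def)
    have "Poly_Mapping.lookup m (inv_into UNIV e (e i)) = Poly_Mapping.lookup m' (inv_into UNIV e (e i))"
      by (rule digits_unique[where k = ?n and Q = B])
        (use bound that w_alt e in \<open>auto simp: bij_betw_def\<close>)
    then show "Poly_Mapping.lookup m i = Poly_Mapping.lookup m' i"
      using e by (simp add: bij_betw_def)
  qed
  define P where "P = (\<Sum>m\<in>Poly_Mapping.keys p. monom (Poly_Mapping.lookup p m) (w m))"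
  have "poly P t = 0" for t
  proof -
    have "poly P t = mpoly_eval p (\<chi> i. t ^ B ^ e i)"
      by (simp add: P_def poly_sum poly_monom mpoly_eval_def w_def power_sum mult.commute
          flip: power_mult)
    then show ?thesis using zero by simp
  qed
  then have "P = 0"
    using inf poly_roots_finite[of P] by auto
  then have "0 = coeff P (w m0)" by simp
  also have "\<dots> = (\<Sum>m\<in>Poly_Mapping.keys p. if m = m0 then Poly_Mapping.lookup p m else 0)"
    unfolding P_def coeff_sum coeff_monom by (rule sum.cong) (use w_inj in auto)
  also have "\<dots> = Poly_Mapping.lookup p m0"
    by (simp add: in_keys_iff)
  finally show "Poly_Mapping.lookup p m0 = Poly_Mapping.lookup 0 m0" by simp
qed

text \<open>Turns later identities between polynomials into identities between values, with no
  computation of coefficients.\<close>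

lemma mpoly_eqI:
  fixes p q :: "('n::finite, 'k::field) mpoly"
  assumes "infinite (UNIV :: 'k set)" "\<And>a. mpoly_eval p a = mpoly_eval q a"
  shows "p = q"
  using mpoly_eq_0I[of "p - q"] assms by (simp add: mpoly_eval_diff)

section \<open>Congruences modulo an ideal\<close>

lemma ideal_cong_mult:
  assumes J: "ring_ideal.subspace J" and "a - a' \<in> J" "b - b' \<in> J"
  shows "a * b - a' * b' \<in> J"
proof -
  have "a * b - a' * b' = b * (a - a') + a' * (b - b')"
    by (simp add: algebra_simps)
  then show ?thesis
    using assms by (simp add: ring_ideal.subspace_def)
qed

lemma ideal_cong_power:
  assumes "ring_ideal.subspace J" "a - a' \<in> J"
  shows "a ^ k - a' ^ k \<in> J"
  by (induction k) (use assms in \<open>auto intro: ideal_cong_mult simp: ring_ideal.subspace_0\<close>)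

lemma ideal_cong_prod:
  assumes "ring_ideal.subspace J" "\<And>x. x \<in> A \<Longrightarrow> g x - g' x \<in> J"
  shows "prod g A - prod g' A \<in> J"
  using assms(2)
  by (induction A rule: infinite_finite_induct)
    (use assms(1) in \<open>auto intro: ideal_cong_mult simp: ring_ideal.subspace_0\<close>)

lemma ideal_cong_sum:
  assumes "ring_ideal.subspace J" "\<And>x. x \<in> A \<Longrightarrow> g x - g' x \<in> J"
  shows "sum g A - sum g' A \<in> J"
  using ring_ideal.subspace_sum[OF assms(1), of A "\<lambda>x. g x - g' x"] assms(2)
  by (simp add: sum_subtractf)

lemma ideal_cong_subst:
  assumes J: "ring_ideal.subspace J" and "\<And>i. G i - G' i \<in> J"
  shows "mpoly_subst p G - mpoly_subst p G' \<in> J"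
  unfolding mpoly_subst_def
  by (intro ideal_cong_sum[OF J] ideal_cong_mult[OF J] ideal_cong_prod[OF J] ideal_cong_power[OF J])
    (use assms in \<open>simp_all add: ring_ideal.subspace_0\<close>)

section \<open>Algebraic dependence\<close>

text \<open>Gaussian elimination: an unknown occurring in equation \<open>b\<close> is eliminated
  from the other equations, at the cost of one equation and one unknown.\<close>

lemma homogeneous_system_solvable:
  fixes M :: "'a \<Rightarrow> 'b \<Rightarrow> 'k::field"
  assumes "finite B" "finite A" "card B < card A"
  shows "\<exists>c. (\<exists>a\<in>A. c a \<noteq> 0) \<and> (\<forall>b\<in>B. (\<Sum>a\<in>A. c a * M a b) = 0)"
  using assms
proof (induction B arbitrary: A M rule: finite_induct)
  case empty
  then have "A \<noteq> {}" by auto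
  then show ?case by (intro exI[of _ "\<lambda>_. 1"]) auto
next
  case (insert b B)
  show ?case
  proof (cases "\<forall>a\<in>A. M a b = 0")
    case True
    obtain c where "\<exists>a\<in>A. c a \<noteq> 0" "\<forall>b\<in>B. (\<Sum>a\<in>A. c a * M a b) = 0"
      using insert.IH[of A M] insert.prems insert.hyps by auto
    then show ?thesis using True by (intro exI[of _ c]) auto
  next
    case False
    then obtain a0 where a0: "a0 \<in> A" "M a0 b \<noteq> 0" by auto
    define A' where "A' = A - {a0}"
    define N where "N a b' = M a b' - M a b / M a0 b * M a0 b'" for a b'
    have "card B < card A'"
      using insert a0 by (simp add: A'_def)
    then obtain c where c: "\<exists>a\<in>A'. c a \<noteq> 0" "\<forall>b'\<in>B. (\<Sum>a\<in>A'. c a * N a b') = 0"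
      using insert.IH[of A' N] insert.prems by (auto simp: A'_def)
    \<comment> \<open>The value at \<open>a0\<close> is the one that equation \<open>b\<close>
      forces.\<close>
    define d where "d = c(a0 := - (\<Sum>a\<in>A'. c a * M a b) / M a0 b)"
    have split: "(\<Sum>a\<in>A. d a * M a b') = d a0 * M a0 b' + (\<Sum>a\<in>A'. c a * M a b')" for b'
    proof -
      have "(\<Sum>a\<in>A. d a * M a b') = d a0 * M a0 b' + (\<Sum>a\<in>A'. d a * M a b')"
        unfolding A'_def using a0 insert.prems by (simp add: sum.remove)
      also have "(\<Sum>a\<in>A'. d a * M a b') = (\<Sum>a\<in>A'. c a * M a b')"
        by (rule sum.cong) (auto simp: d_def A'_def)
      finally show ?thesis .
    qed
    have "(\<Sum>a\<in>A. d a * M a b') = 0" if "b' \<in> insert b B" for b'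
    proof (cases "b' = b")
      case True
      then show ?thesis
        unfolding split using a0 by (simp add: d_def)
    next
      case False
      then have "0 = (\<Sum>a\<in>A'. c a * N a b')"
        using c that by auto
      also have "\<dots> = (\<Sum>a\<in>A'. c a * M a b') - (\<Sum>a\<in>A'. c a * M a b) / M a0 b * M a0 b'"
        by (simp add: N_def right_diff_distrib sum_subtractf sum_distrib_right sum_divide_distrib mult.assoc)
      finally show ?thesis unfolding split by (simp add: d_def)
    qed
    moreover have "\<exists>a\<in>A. d a \<noteq> 0"
      using c(1) by (auto simp: d_def A'_def)
    ultimately show ?thesis by blast
  qed
qed

section \<open>Total degree and the number of monomials of bounded degree\<close>

definition mdegree :: "('n::finite \<Rightarrow>\<^sub>0 nat) \<Rightarrow> nat" where
  "mdegree m = (\<Sum>i\<in>UNIV. Poly_Mapping.lookup m i)"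

definition degree_le :: "nat \<Rightarrow> ('n::finite, 'k::comm_ring_1) mpoly \<Rightarrow> bool" where
  "degree_le d p \<longleftrightarrow> (\<forall>m\<in>Poly_Mapping.keys p. mdegree m \<le> d)"

lemma mdegree_add [simp]: "mdegree (m + m') = mdegree m + mdegree m'"
  by (simp add: mdegree_def lookup_add sum.distrib)

lemma mdegree_single [simp]: "mdegree (Poly_Mapping.single i k) = k"
  by (simp add: mdegree_def lookup_single when_def)

lemma lookup_le_mdegree: "Poly_Mapping.lookup m i \<le> mdegree m"
  unfolding mdegree_def by (rule member_le_sum) auto

lemma degree_le_mono: "degree_le d p \<Longrightarrow> d \<le> d' \<Longrightarrow> degree_le d' p"
  by (force simp: degree_le_def)

lemma ex_degree_le:
  fixes g :: "'a \<Rightarrow> ('n::finite, 'k::comm_ring_1) mpoly"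
  assumes "finite A"
  shows "\<exists>d. \<forall>x\<in>A. degree_le d (g x)"
proof -
  let ?M = "\<Union>x\<in>A. mdegree ` Poly_Mapping.keys (g x)"
  have "finite ?M" using assms by simp
  then have "\<forall>x\<in>A. degree_le (Max ?M) (g x)"
    by (force simp: degree_le_def intro!: Max_ge)
  then show ?thesis ..
qed

lemma degree_le_1 [simp]: "degree_le d 1"
  by (simp add: degree_le_def mdegree_def)

lemma degree_le_mult: "degree_le d p \<Longrightarrow> degree_le e q \<Longrightarrow> degree_le (d + e) (p * q)"
  using keys_mult[of p q] by (fastforce simp: degree_le_def intro: add_mono)

lemma degree_le_power: "degree_le d p \<Longrightarrow> degree_le (k * d) (p ^ k)"
  by (induction k) (auto intro: degree_le_mult)

lemma degree_le_prod:
  "(\<And>x. x \<in> A \<Longrightarrow> degree_le (d x) (g x)) \<Longrightarrow> degree_le (sum d A) (prod g A)"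
  by (induction A rule: infinite_finite_induct) (auto intro: degree_le_mult)

text \<open>Every single exponent is at most \<open>N\<close>; this crude bound already has the
  right order in \<open>N\<close>.\<close>

lemma card_mdegree_le:
  "finite {m :: 'n::finite \<Rightarrow>\<^sub>0 nat. mdegree m \<le> N}"
  "card {m :: 'n::finite \<Rightarrow>\<^sub>0 nat. mdegree m \<le> N} \<le> Suc N ^ CARD('n)"
proof -
  let ?S = "{m :: 'n \<Rightarrow>\<^sub>0 nat. mdegree m \<le> N}"
  let ?T = "PiE (UNIV :: 'n set) (\<lambda>_. {..N})"
  have sub: "Poly_Mapping.lookup ` ?S \<subseteq> ?T"
    by (auto intro: order.trans[OF lookup_le_mdegree])
  have inj: "inj_on Poly_Mapping.lookup ?S"
    by (rule inj_onI) (simp add: poly_mapping_eqI)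
  have fin: "finite ?T" by (intro finite_PiE) auto
  show "finite ?S"
    using finite_imageD[OF finite_subset[OF sub fin] inj] .
  have "card ?S \<le> card ?T"
    using card_inj_on_le[OF inj sub fin] .
  also have "card ?T = Suc N ^ CARD('n)"
    by (simp add: card_PiE)
  finally show "card ?S \<le> Suc N ^ CARD('n)" .
qed

text \<open>With \<open>B\<close> exponents per factor there are \<open>B ^ (n + 1)\<close> products but only \<open>O(B ^ n)\<close> monomials
  that can occur in them.\<close>
lemma algebraic_dependence:
  fixes g :: "nat \<Rightarrow> ('n::finite, 'k::field) mpoly"
  obtains B :: nat and c :: "(nat \<Rightarrow> nat) \<Rightarrow> 'k"
  where "\<exists>\<alpha>\<in>PiE {..CARD('n)} (\<lambda>_. {..<B}). c \<alpha> \<noteq> 0"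
    and "(\<Sum>\<alpha>\<in>PiE {..CARD('n)} (\<lambda>_. {..<B}). Const (c \<alpha>) * (\<Prod>j\<le>CARD('n). g j ^ \<alpha> j)) = 0"
proof -
  let ?n = "CARD('n)"
  obtain d where d: "\<And>j. j \<le> ?n \<Longrightarrow> degree_le d (g j)"
    using ex_degree_le[of "{..?n}" g] by auto
  \<comment> \<open>Chosen to exceed the factor by which the number of monomials may surpass
    \<open>B ^ ?n\<close>, so that there are fewer monomials than the \<open>B ^ (?n + 1)\<close>
    products.\<close>
  define B where "B = Suc (Suc (Suc ?n * d) ^ ?n)"
  define S where "S = PiE {..?n} (\<lambda>_. {..<B})"
  \<comment> \<open>Bounds the degree of a product of \<open>?n + 1\<close> powers with exponents
    below \<open>B\<close> and bases of degree at most \<open>d\<close>.\<close>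
  define N where "N = Suc ?n * d * B"
  define T where "T = {m :: 'n \<Rightarrow>\<^sub>0 nat. mdegree m \<le> N}"
  define h where "h \<alpha> = (\<Prod>j\<le>?n. g j ^ \<alpha> j)" for \<alpha>
  have "Suc N ^ ?n \<le> (B * Suc (Suc ?n * d)) ^ ?n"
    by (intro power_mono) (auto simp: N_def B_def algebra_simps)
  also have "\<dots> = B ^ ?n * Suc (Suc ?n * d) ^ ?n"
    by (simp only: power_mult_distrib)
  also have "\<dots> < B ^ ?n * B"
    by (intro mult_strict_left_mono) (auto simp: B_def)
  also have "\<dots> = card S"
    by (simp add: S_def card_PiE)
  finally have "card T < card S"
    using card_mdegree_le(2)[where 'n = 'n, of N] by (simp add: T_def)
  moreover have "finite S"
    by (auto simp: S_def intro: finite_PiE)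
  moreover have "finite T"
    unfolding T_def by (rule card_mdegree_le)
  \<comment> \<open>One unknown per exponent vector \<open>\<alpha>\<close>, one equation per
    monomial \<open>m\<close>.\<close>
  ultimately obtain c where c: "\<exists>\<alpha>\<in>S. c \<alpha> \<noteq> 0"
    and sol: "\<forall>m\<in>T. (\<Sum>\<alpha>\<in>S. c \<alpha> * Poly_Mapping.lookup (h \<alpha>) m) = 0"
    using homogeneous_system_solvable[of T S "\<lambda>\<alpha>. Poly_Mapping.lookup (h \<alpha>)"] by blast
  have lookup_Const_mult: "Poly_Mapping.lookup (Const x * p) m = x * Poly_Mapping.lookup p m"
    for x and p :: "('n, 'k) mpoly" and m
  proof -
    have "Const x * p = (\<Sum>m\<in>Poly_Mapping.keys p. Const x * Poly_Mapping.single m (Poly_Mapping.lookup p m))"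
      by (subst (1) mpoly_sum_single[of p]) (rule sum_distrib_left)
    then show ?thesis
      by (simp add: lookup_sum mult_single lookup_single when_def in_keys_iff)
  qed
  have deg: "degree_le N (h \<alpha>)" if "\<alpha> \<in> S" for \<alpha>
  proof -
    have "degree_le (\<Sum>j\<le>?n. \<alpha> j * d) (h \<alpha>)"
      unfolding h_def by (intro degree_le_prod degree_le_power d) auto
    moreover have "(\<Sum>j\<le>?n. \<alpha> j * d) \<le> (\<Sum>j\<le>?n. B * d)"
      using that by (intro sum_mono mult_right_mono) (auto simp: S_def PiE_def Pi_def less_imp_le)
    then have "(\<Sum>j\<le>?n. \<alpha> j * d) \<le> N"
      by (simp add: N_def algebra_simps)
    ultimately show ?thesis by (rule degree_le_mono)
  qed
  have "(\<Sum>\<alpha>\<in>S. Const (c \<alpha>) * h \<alpha>) = 0"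
  proof (rule poly_mapping_eqI)
    fix m
    have "(\<Sum>\<alpha>\<in>S. c \<alpha> * Poly_Mapping.lookup (h \<alpha>) m) = 0"
    proof (cases "m \<in> T")
      case False
      then have "Poly_Mapping.lookup (h \<alpha>) m = 0" if "\<alpha> \<in> S" for \<alpha>
        using deg[OF that] by (auto simp: degree_le_def T_def in_keys_iff)
      then show ?thesis by simp
    qed (use sol in blast)
    then show "Poly_Mapping.lookup (\<Sum>\<alpha>\<in>S. Const (c \<alpha>) * h \<alpha>) m = Poly_Mapping.lookup 0 m"
      by (simp add: lookup_sum lookup_Const_mult)
  qed
  then show thesis
    using that[of B c] c by (simp add: S_def h_def)
qed

section \<open>Elements of low degree in the ideal\<close>

text \<open>
  The generators \<open>F i - x\<^sub>i ^ Q\<close> with \<open>degree (F i) < Q\<close> have the pairwise coprime leading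
  monomials \<open>x\<^sub>i ^ Q\<close>, so reduced monomials stay linearly independent modulo the ideal they
  generate. Below, \<open>nf_coeff b a\<close> is the coefficient of the reduced monomial \<open>b\<close> in the
  normal form of the monomial \<open>a\<close>.
\<close>

context
  fixes F :: "'n::finite \<Rightarrow> ('n, 'k::field) mpoly" and Q :: nat
  assumes deg_F: "m \<in> Poly_Mapping.keys (F i) \<Longrightarrow> mdegree m < Q"
begin

function nf_coeff :: "('n \<Rightarrow>\<^sub>0 nat) \<Rightarrow> ('n \<Rightarrow>\<^sub>0 nat) \<Rightarrow> 'k" where
  "nf_coeff b a =
    (if \<forall>i. Poly_Mapping.lookup a i < Q then (if a = b then 1 else 0)
     else (\<Sum>m\<in>Poly_Mapping.keys (F (SOME i. Q \<le> Poly_Mapping.lookup a i)).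
       Poly_Mapping.lookup (F (SOME i. Q \<le> Poly_Mapping.lookup a i)) m *
       nf_coeff b (a - Poly_Mapping.single (SOME i. Q \<le> Poly_Mapping.lookup a i) Q + m)))"
  by auto

lemma split_off_single:
  assumes "Q \<le> Poly_Mapping.lookup a i"
  shows "a = a - Poly_Mapping.single i Q + Poly_Mapping.single i Q"
  by (rule poly_mapping_eqI) (use assms in \<open>auto simp: lookup_add lookup_minus lookup_single when_def\<close>)

text \<open>A rewriting step replaces a factor of degree \<open>Q\<close> by a monomial of smaller
  degree.\<close>

termination nf_coeff
proof (relation "Wellfounded.measure (\<lambda>(b, a). mdegree a)", goal_cases)
  case (2 b a m)
  define i where "i = (SOME i. Q \<le> Poly_Mapping.lookup a i)"
  have "Q \<le> Poly_Mapping.lookup a i"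
    unfolding i_def by (rule someI_ex) (use 2 in \<open>auto simp: not_less\<close>)
  then have "mdegree a = mdegree (a - Poly_Mapping.single i Q) + Q"
    using arg_cong[OF split_off_single, of a i mdegree] by simp
  then show ?case
    using deg_F[of m i] 2 by (simp flip: i_def)
qed simp

declare nf_coeff.simps [simp del]

lemma nf_coeff_reduced:
  "(\<And>i. Poly_Mapping.lookup a i < Q) \<Longrightarrow> nf_coeff b a = (if a = b then 1 else 0)"
  by (subst nf_coeff.simps) simp

text \<open>Confluence: the normal form does not depend on the variable chosen by
  \<open>SOME\<close>. If the choice \<open>j\<close> differs from \<open>i\<close>, both
  \<open>Q\<close>-th powers divide the monomial and the two rewritings commute; the induction is on
  the degree, which rewriting lowers.\<close>

lemma nf_coeff_step:
  "nf_coeff b (a + Poly_Mapping.single i Q) =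
    (\<Sum>m\<in>Poly_Mapping.keys (F i). Poly_Mapping.lookup (F i) m * nf_coeff b (a + m))"
proof (induction "mdegree a" arbitrary: a i rule: less_induct)
  case less
  let ?c = "a + Poly_Mapping.single i Q"
  define j where "j = (SOME j. Q \<le> Poly_Mapping.lookup ?c j)"
  have ex: "Q \<le> Poly_Mapping.lookup ?c i"
    by (simp add: lookup_add)
  then have j: "Q \<le> Poly_Mapping.lookup ?c j"
    unfolding j_def by (rule someI)
  define a1 where "a1 = ?c - Poly_Mapping.single j Q"
  have c1: "?c = a1 + Poly_Mapping.single j Q"
    unfolding a1_def using j by (rule split_off_single)
  have eq: "nf_coeff b ?c =
      (\<Sum>m\<in>Poly_Mapping.keys (F j). Poly_Mapping.lookup (F j) m * nf_coeff b (a1 + m))"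
  proof -
    have "\<not> (\<forall>i. Poly_Mapping.lookup ?c i < Q)"
      using ex not_less by blast
    then show ?thesis
      by (subst nf_coeff.simps) (simp only: if_False flip: j_def a1_def)
  qed
  show ?case
  proof (cases "j = i")
    case True
    then have "a1 = a" using c1 by simp
    then show ?thesis using eq True by simp
  next
    case False
    then have "Q \<le> Poly_Mapping.lookup a j"
      using j by (simp add: lookup_add lookup_single when_def)
    define a2 where "a2 = a - Poly_Mapping.single j Q"
    have a: "a = a2 + Poly_Mapping.single j Q"
      unfolding a2_def using \<open>Q \<le> Poly_Mapping.lookup a j\<close> by (rule split_off_single)
    have a1: "a1 = a2 + Poly_Mapping.single i Q"
    proof -
      have "a1 + Poly_Mapping.single j Q = a + Poly_Mapping.single i Q"
        by (rule c1[symmetric])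
      also have "\<dots> = a2 + Poly_Mapping.single i Q + Poly_Mapping.single j Q"
        by (subst a) (simp only: add_ac)
      finally show ?thesis by simp
    qed
    have less': "mdegree (a2 + m) < mdegree a" if "m \<in> Poly_Mapping.keys (F l)" for l m
      using deg_F[OF that] by (simp add: a)
    \<comment> \<open>After both rewritings the double sum is symmetric in \<open>i\<close> and
      \<open>j\<close>, so it can be summed in the other order and folded back.\<close>
    have "nf_coeff b ?c = (\<Sum>m\<in>Poly_Mapping.keys (F j). \<Sum>m'\<in>Poly_Mapping.keys (F i).
        Poly_Mapping.lookup (F j) m * Poly_Mapping.lookup (F i) m' * nf_coeff b (a2 + m + m'))"
      unfolding eq a1
    proof (intro sum.cong refl)
      fix m assume m: "m \<in> Poly_Mapping.keys (F j)"
      have "nf_coeff b (a2 + Poly_Mapping.single i Q + m) =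
          nf_coeff b (a2 + m + Poly_Mapping.single i Q)"
        by (simp add: add_ac)
      then show "Poly_Mapping.lookup (F j) m * nf_coeff b (a2 + Poly_Mapping.single i Q + m) =
          (\<Sum>m'\<in>Poly_Mapping.keys (F i).
            Poly_Mapping.lookup (F j) m * Poly_Mapping.lookup (F i) m' * nf_coeff b (a2 + m + m'))"
        using less[OF less'[OF m], of i] by (simp add: sum_distrib_left mult.assoc)
    qed
    also have "\<dots> = (\<Sum>m'\<in>Poly_Mapping.keys (F i). \<Sum>m\<in>Poly_Mapping.keys (F j).
        Poly_Mapping.lookup (F j) m * Poly_Mapping.lookup (F i) m' * nf_coeff b (a2 + m + m'))"
      by (rule sum.swap)
    also have "\<dots> = (\<Sum>m'\<in>Poly_Mapping.keys (F i). Poly_Mapping.lookup (F i) m' * nf_coeff b (a + m'))"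
    proof (intro sum.cong refl)
      fix m' assume m': "m' \<in> Poly_Mapping.keys (F i)"
      have "nf_coeff b (a + m') = nf_coeff b (a2 + m' + Poly_Mapping.single j Q)"
        by (simp add: a add_ac)
      also have "\<dots> = (\<Sum>m\<in>Poly_Mapping.keys (F j).
          Poly_Mapping.lookup (F j) m * nf_coeff b (a2 + m' + m))"
        by (rule less[OF less'[OF m']])
      finally show "(\<Sum>m\<in>Poly_Mapping.keys (F j).
          Poly_Mapping.lookup (F j) m * Poly_Mapping.lookup (F i) m' * nf_coeff b (a2 + m + m')) =
          Poly_Mapping.lookup (F i) m' * nf_coeff b (a + m')"
        by (simp add: sum_distrib_left mult_ac add_ac)
    qed
    finally show ?thesis .
  qed
qed

text \<open>The linear extension of \<open>nf_coeff b\<close> from monomials to polynomials.\<close>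

definition nf_functional :: "('n \<Rightarrow>\<^sub>0 nat) \<Rightarrow> ('n, 'k) mpoly \<Rightarrow> 'k" where
  "nf_functional b p = (\<Sum>m\<in>Poly_Mapping.keys p. Poly_Mapping.lookup p m * nf_coeff b m)"

lemma nf_functional_superset:
  assumes "finite A" "Poly_Mapping.keys p \<subseteq> A"
  shows "nf_functional b p = (\<Sum>m\<in>A. Poly_Mapping.lookup p m * nf_coeff b m)"
  unfolding nf_functional_def
  by (rule sum.mono_neutral_left) (use assms in \<open>auto simp: in_keys_iff\<close>)

lemma nf_functional_add: "nf_functional b (p + q) = nf_functional b p + nf_functional b q"
proof -
  let ?A = "Poly_Mapping.keys p \<union> Poly_Mapping.keys q"
  have "Poly_Mapping.keys (p + q) \<subseteq> ?A"
    by (rule Poly_Mapping.keys_add)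
  then show ?thesis
    by (simp add: nf_functional_superset[of ?A] lookup_add sum.distrib distrib_right)
qed

lemma nf_functional_0 [simp]: "nf_functional b 0 = 0"
  by (simp add: nf_functional_def)

lemma nf_functional_sum: "nf_functional b (sum g A) = (\<Sum>x\<in>A. nf_functional b (g x))"
  by (induction A rule: infinite_finite_induct) (simp_all add: nf_functional_add)

lemma nf_functional_single [simp]:
  "nf_functional b (Poly_Mapping.single m c) = c * nf_coeff b m"
  by (simp add: nf_functional_def)

lemma Var_power: "Var i ^ k = Poly_Mapping.single (Poly_Mapping.single i k) 1"
  by (induction k) (simp_all add: Var_def mult_single flip: single_add)

text \<open>For a monomial \<open>p\<close> this is \<open>nf_coeff_step\<close>; linearity does the
  rest.\<close>

lemma nf_functional_generator: "nf_functional b (p * (F i - Var i ^ Q)) = 0"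
proof -
  have single: "nf_functional b (Poly_Mapping.single m c * (F i - Var i ^ Q)) = 0" for m c
  proof -
    let ?s = "Poly_Mapping.single m c"
    have "?s * F i = (\<Sum>m'\<in>Poly_Mapping.keys (F i).
        ?s * Poly_Mapping.single m' (Poly_Mapping.lookup (F i) m'))"
      by (subst (1) mpoly_sum_single[of "F i"]) (rule sum_distrib_left)
    also have "\<dots> = (\<Sum>m'\<in>Poly_Mapping.keys (F i).
        Poly_Mapping.single (m + m') (c * Poly_Mapping.lookup (F i) m'))"
      by (simp only: mult_single)
    finally have "nf_functional b (?s * F i) = (\<Sum>m'\<in>Poly_Mapping.keys (F i).
        c * Poly_Mapping.lookup (F i) m' * nf_coeff b (m + m'))"
      by (simp only: nf_functional_sum nf_functional_single)
    also have "\<dots> = c * nf_coeff b (m + Poly_Mapping.single i Q)"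
      by (simp only: nf_coeff_step sum_distrib_left mult.assoc)
    also have "\<dots> = nf_functional b (?s * Var i ^ Q)"
      by (simp add: Var_power mult_single)
    finally have "nf_functional b (?s * F i) = nf_functional b (?s * Var i ^ Q)" .
    then show ?thesis
      using nf_functional_add[of b "?s * (F i - Var i ^ Q)" "?s * Var i ^ Q"]
      by (simp add: right_diff_distrib)
  qed
  have "p * (F i - Var i ^ Q) = (\<Sum>m\<in>Poly_Mapping.keys p.
      Poly_Mapping.single m (Poly_Mapping.lookup p m) * (F i - Var i ^ Q))"
    by (subst (1) mpoly_sum_single[of p]) (rule sum_distrib_right)
  then show ?thesis
    by (simp add: nf_functional_sum single)
qed

text \<open>All functionals \<open>nf_functional b\<close> vanish on the ideal, but below degree
  \<open>Q\<close> every monomial is reduced and they read off the coefficients of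
  \<open>p\<close>.\<close>

lemma low_degree_in_ideal_eq_0:
  assumes p: "p \<in> ring_ideal.span (range (\<lambda>i. F i - Var i ^ Q))"
    and low: "\<And>m. m \<in> Poly_Mapping.keys p \<Longrightarrow> mdegree m < Q"
  shows "p = 0"
proof (rule poly_mapping_eqI)
  fix b
  have "nf_functional b p = 0"
    using p by (induction rule: ring_ideal.span_induct_alt)
      (auto simp: nf_functional_add nf_functional_generator)
  moreover have "nf_functional b p =
      (\<Sum>m\<in>Poly_Mapping.keys p. if m = b then Poly_Mapping.lookup p m else 0)"
    unfolding nf_functional_def
    by (intro sum.cong refl)
      (use low in \<open>auto simp: nf_coeff_reduced order.strict_trans1[OF lookup_le_mdegree]\<close>)
  ultimately show "Poly_Mapping.lookup p b = Poly_Mapping.lookup 0 b"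
    by (simp add: in_keys_iff split: if_splits)
qed

end

section \<open>A Nullstellensatz\<close>

lemma mpoly_subst_Var:
  fixes p :: "('n::finite, 'k::field) mpoly"
  assumes "infinite (UNIV :: 'k set)"
  shows "mpoly_subst p Var = p"
  using assms by (rule mpoly_eqI) (simp add: mpoly_eval_subst)

lemma mpoly_subst_Const:
  fixes p :: "('n::finite, 'k::field) mpoly"
  assumes "infinite (UNIV :: 'k set)"
  shows "mpoly_subst p (\<lambda>i. Const (a $ i)) = (Const (mpoly_eval p a) :: ('n, 'k) mpoly)"
  using assms by (rule mpoly_eqI) (simp add: mpoly_eval_subst)

definition poly_at :: "'k::field poly \<Rightarrow> ('n::finite, 'k) mpoly \<Rightarrow> ('n, 'k) mpoly" where
  "poly_at R u = (\<Sum>k\<le>degree R. Const (coeff R k) * u ^ k)"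

lemma mpoly_eval_poly_at [simp]: "mpoly_eval (poly_at R u) a = poly R (mpoly_eval u a)"
  by (simp add: poly_at_def mpoly_eval_sum mpoly_eval_mult mpoly_eval_power poly_altdef)

text \<open>
  A common eigenvector for the multiplications by the variables on which no power of \<open>D\<close> vanishes,
  built one variable at a time: a minimal product of factors \<open>x\<^sub>i - r\<close> (and powers of \<open>D\<close>)
  that kills it is split off.
\<close>
lemma ex_eigenvector:
  fixes D v :: "('n::finite, 'k::alg_closed_field) mpoly"
  assumes I: "ring_ideal.subspace I" and inf: "infinite (UNIV :: 'k set)"
    and v: "\<And>k. D ^ k * v \<notin> I"
    and "R \<noteq> 0" "poly_at R (Var i) * v \<in> I"
  shows "\<exists>w r. (\<forall>k. D ^ k * (w * v) \<notin> I) \<and> (Var i - Const r) * (w * v) \<in> I"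
  using v assms(4-)
proof (induction "degree R" arbitrary: R v rule: less_induct)
  case less
  have scale: "c * x \<in> I" if "x \<in> I" for c x
    using I that by (simp add: ring_ideal.subspace_def)
  show ?case
  proof (cases "degree R = 0")
    \<comment> \<open>A nonzero constant \<open>R\<close> would put \<open>v\<close> itself into
      \<open>I\<close>.\<close>
    case True
    then obtain c where c: "R = [:c:]" "c \<noteq> 0"
      using less.prems(2) by (auto elim: degree_eq_zeroE)
    then have "Const (inverse c) * (poly_at R (Var i) * v) = D ^ 0 * v"
      by (simp add: poly_at_def mult_single flip: mult.assoc)
    then show ?thesis
      using scale[OF less.prems(3), of "Const (inverse c)"] less.prems(1)[of 0] by simp
  next
    case False
    then obtain r where "poly R r = 0"
      using alg_closed_imp_poly_has_root by blast
    then obtain S where R: "R = [:- r, 1:] * S"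
      by (auto simp: poly_eq_0_iff_dvd)
    have "S \<noteq> 0" using R less.prems(2) by auto
    then have deg: "degree S < degree R"
      unfolding R by (subst degree_mult_eq) auto
    define W :: "('n, 'k) mpoly" where "W = poly_at S (Var i)"
    have W: "poly_at R (Var i) = (Var i - Const r) * W"
      by (rule mpoly_eqI[OF inf])
        (simp add: R W_def mpoly_eval_mult mpoly_eval_diff algebra_simps)
    show ?thesis
    proof (cases "\<forall>k. D ^ k * (W * v) \<notin> I")
      case True
      moreover have "(Var i - Const r) * (W * v) \<in> I"
        using less.prems(3) by (simp add: W mult.assoc)
      ultimately show ?thesis by blast
    next
      \<comment> \<open>The remaining factor \<open>S\<close> kills \<open>D ^ k * v\<close>, which
        can replace \<open>v\<close> while the degree drops; the power of \<open>D\<close> is then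
        absorbed into the multiplier.\<close>
      case False
      then obtain k where k: "D ^ k * (W * v) \<in> I" by blast
      have "D ^ l * (D ^ k * v) \<notin> I" for l
        using less.prems(1)[of "l + k"] by (simp add: power_add mult.assoc)
      moreover have "W * (D ^ k * v) \<in> I"
        using k by (simp add: mult.left_commute)
      ultimately obtain w r where "\<forall>l. D ^ l * (w * (D ^ k * v)) \<notin> I"
        "(Var i - Const r) * (w * (D ^ k * v)) \<in> I"
        using less.hyps[OF deg _ \<open>S \<noteq> 0\<close>] unfolding W_def by blast
      then show ?thesis
        by (intro exI[of _ "w * D ^ k"] exI[of _ r]) (simp add: mult.assoc)
    qed
  qed
qed

text \<open>If no power of \<open>D\<close> lies in \<open>I\<close>, there is a common eigenvector
  \<open>v\<close> modulo \<open>I\<close> with eigenvalues forming a point \<open>a\<close>. Modulo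
  the annihilator \<open>J\<close> of \<open>v\<close> every polynomial equals its value at
  \<open>a\<close>. As \<open>J\<close> contains \<open>I\<close> but no nonzero constant,
  \<open>a\<close> is a zero of \<open>I\<close>, hence of \<open>D\<close>; then
  \<open>D * v\<close> lies in \<open>I\<close>, a contradiction.\<close>

lemma zero_dim_nullstellensatz:
  fixes D :: "('n::finite, 'k::alg_closed_field) mpoly"
  assumes I: "ring_ideal.subspace I" and inf: "infinite (UNIV :: 'k set)"
    and R: "\<And>i. \<exists>R. R \<noteq> 0 \<and> poly_at R (Var i) \<in> I"
    and D: "\<And>a. (\<forall>p\<in>I. mpoly_eval p a = 0) \<Longrightarrow> mpoly_eval D a = 0"
  shows "\<exists>k. D ^ k \<in> I"
proof (rule ccontr)
  assume nilp: "\<nexists>k. D ^ k \<in> I"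
  have scale: "c * x \<in> I" if "x \<in> I" for c x
    using I that by (simp add: ring_ideal.subspace_def)
  have "\<exists>v r. (\<forall>k. D ^ k * v \<notin> I) \<and> (\<forall>i\<in>A. (Var i - Const (r i)) * v \<in> I)" if "finite A" for A :: "'n set"
    using that
  proof (induction A rule: finite_induct)
    case empty
    then show ?case using nilp by (intro exI[of _ 1]) auto
  next
    case (insert i A)
    then obtain v r where v: "\<And>k. D ^ k * v \<notin> I" "\<And>i. i \<in> A \<Longrightarrow> (Var i - Const (r i)) * v \<in> I"
      by blast
    obtain R where R: "R \<noteq> 0" "poly_at R (Var i) \<in> I"
      using R[of i] by blast
    have "poly_at R (Var i) * v \<in> I"
      using scale[OF R(2), of v] by (simp add: mult.commute)
    then obtain w s where w: "\<forall>k. D ^ k * (w * v) \<notin> I" "(Var i - Const s) * (w * v) \<in> I"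
      using ex_eigenvector[OF I inf v(1) R(1)] by blast
    moreover have "(Var j - Const (r j)) * (w * v) \<in> I" if "j \<in> A" for j
      using scale[OF v(2)[OF that], of w] by (simp only: mult.left_commute[of w])
    ultimately show ?case
      using insert.hyps by (intro exI[of _ "w * v"] exI[of _ "r(i := s)"]) auto
  qed
  from this[of UNIV] obtain v r
    where v: "\<And>k. D ^ k * v \<notin> I" "\<And>i. (Var i - Const (r i)) * v \<in> I"
    by auto
  define a :: "'k ^ 'n" where "a = (\<chi> i. r i)"
  define J where "J = {p. p * v \<in> I}"
  have J: "ring_ideal.subspace J"
    using I by (auto simp: J_def ring_ideal.subspace_def distrib_right mult.assoc)
  have eigen: "p - Const (mpoly_eval p a) \<in> J" for p
    using ideal_cong_subst[OF J, of Var "\<lambda>i. Const (a $ i)" p] v(2)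
    by (simp add: mpoly_subst_Var[OF inf] mpoly_subst_Const[OF inf]) (simp add: J_def a_def)
  have unit: "c = 0" if "Const c \<in> J" for c
  proof (rule ccontr)
    assume "c \<noteq> 0"
    then have "Const (inverse c) * (Const c * v) = D ^ 0 * v"
      by (simp add: mult_single flip: mult.assoc)
    then show False
      using scale[of "Const c * v" "Const (inverse c)"] that v(1)[of 0] by (simp add: J_def)
  qed
  have "mpoly_eval p a = 0" if "p \<in> I" for p
  proof (rule unit)
    have "p \<in> J"
      using scale[OF that, of v] by (simp add: J_def mult.commute)
    then show "Const (mpoly_eval p a) \<in> J"
      using ring_ideal.subspace_diff[OF J _ eigen[of p]] by fastforce
  qed
  then have "D - Const 0 \<in> J"
    using D eigen[of D] by metis
  then show False
    using v(1)[of 1] by (simp add: J_def)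
qed

text \<open>Let \<open>t\<close> be the least exponent with \<open>D ^ t\<close> in
  \<open>I\<close>. If \<open>degree R < t\<close>, multiplying \<open>R(D)\<close> by a power of
  \<open>D\<close> moves its lowest term to exponent \<open>t - 1\<close> and all others into
  \<open>I\<close>, so \<open>D ^ (t - 1)\<close> lies in \<open>I\<close> as well.\<close>

lemma poly_at_nilpotent:
  fixes D :: "('n::finite, 'k::field) mpoly"
  assumes I: "ring_ideal.subspace I" and "D ^ N \<in> I" and R: "R \<noteq> 0" "poly_at R D \<in> I"
  shows "D ^ degree R \<in> I"
proof (rule ccontr)
  assume not: "D ^ degree R \<notin> I"
  have scale: "c * x \<in> I" if "x \<in> I" for c x
    using I that by (simp add: ring_ideal.subspace_def)
  have mono: "D ^ b \<in> I" if "D ^ a \<in> I" "a \<le> b" for a b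
    using scale[OF that(1), of "D ^ (b - a)"] that(2) by (simp flip: power_add)
  define t where "t = (LEAST t. D ^ t \<in> I)"
  have t: "D ^ t \<in> I"
    unfolding t_def using \<open>D ^ N \<in> I\<close> by (rule LeastI)
  have t_min: "D ^ k \<notin> I" if "k < t" for k
    using not_less_Least[of k "\<lambda>t. D ^ t \<in> I"] that by (simp add: t_def)
  define m where "m = (LEAST k. coeff R k \<noteq> 0)"
  have m: "coeff R m \<noteq> 0"
    unfolding m_def by (rule LeastI[of "\<lambda>k. coeff R k \<noteq> 0" "degree R"]) (use R(1) in simp)
  have m_min: "coeff R k = 0" if "k < m" for k
    using not_less_Least[of k "\<lambda>k. coeff R k \<noteq> 0"] that by (simp add: m_def)
  have "m \<le> degree R" using m by (rule le_degree)
  moreover have "degree R < t"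
    using mono[OF t, of "degree R"] not by (meson not_le)
  ultimately have mt: "m < t" by simp
  \<comment> \<open>Gives \<open>e + m = t - 1\<close>; the subtraction is not truncated, by
    \<open>m < t\<close>.\<close>
  define e where "e = t - 1 - m"
  let ?h = "\<lambda>k. Const (coeff R k) * D ^ (e + k)"
  have "(\<Sum>k\<le>degree R. ?h k) = D ^ e * poly_at R D"
    by (simp add: poly_at_def sum_distrib_left power_add mult_ac)
  then have sum: "(\<Sum>k\<le>degree R. ?h k) \<in> I"
    using scale[OF R(2)] by simp
  have "?h k \<in> I" if "k \<noteq> m" for k
  proof (cases "k < m")
    case True
    then show ?thesis using I by (simp add: m_min ring_ideal.subspace_0)
  next
    case False
    then have "t \<le> e + k" using that mt by (simp add: e_def)
    then show ?thesis by (intro scale mono[OF t])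
  qed
  then have "(\<Sum>k\<in>{..degree R} - {m}. ?h k) \<in> I"
    by (intro ring_ideal.subspace_sum[OF I]) auto
  moreover have "(\<Sum>k\<le>degree R. ?h k) = ?h m + (\<Sum>k\<in>{..degree R} - {m}. ?h k)"
    using \<open>m \<le> degree R\<close> by (intro sum.remove) auto
  ultimately have "?h m \<in> I"
    using ring_ideal.subspace_diff[OF I sum] by fastforce
  then have "Const (inverse (coeff R m)) * ?h m \<in> I"
    by (rule scale)
  moreover have "Const (inverse (coeff R m)) * ?h m = D ^ (e + m)"
    using m by (simp add: mult_single flip: mult.assoc)
  ultimately show False
    using t_min[of "e + m"] mt by (simp add: e_def)
qed

text \<open>
  If \<open>g j\<close> is congruent to \<open>u ^ (Q ^ j)\<close>, an algebraic relation between the \<open>g j\<close> becomes a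
  univariate equation for \<open>u\<close>; it is nontrivial because base \<open>Q\<close> digits are unique.
\<close>
lemma ex_annihilating_poly:
  fixes u :: "('n::finite, 'k::field) mpoly"
  assumes I: "ring_ideal.subspace I" and inf: "infinite (UNIV :: 'k set)"
    and g: "\<And>j. j \<le> n \<Longrightarrow> g j - u ^ (Q ^ j) \<in> I"
    and c: "\<exists>\<alpha>\<in>PiE {..n} (\<lambda>_. {..<B}). c \<alpha> \<noteq> 0"
    and rel: "(\<Sum>\<alpha>\<in>PiE {..n} (\<lambda>_. {..<B}). Const (c \<alpha>) * (\<Prod>j\<le>n. g j ^ \<alpha> j)) = 0"
    and Q: "B \<le> Q"
  shows "\<exists>R. R \<noteq> 0 \<and> degree R \<le> Suc n * B * Q ^ n \<and> poly_at R u \<in> I"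
proof -
  define S where "S = PiE {..n} (\<lambda>_. {..<B})"
  define w :: "(nat \<Rightarrow> nat) \<Rightarrow> nat" where "w \<alpha> = (\<Sum>j\<le>n. \<alpha> j * Q ^ j)" for \<alpha>
  define R where "R = (\<Sum>\<alpha>\<in>S. monom (c \<alpha>) (w \<alpha>))"
  have fin: "finite S"
    by (auto simp: S_def intro: finite_PiE)
  have less: "\<alpha> j < B" if "\<alpha> \<in> S" "j \<le> n" for \<alpha> j
    using that by (auto simp: S_def)
  have w_inj: "\<alpha> = \<beta>" if "\<alpha> \<in> S" "\<beta> \<in> S" "w \<alpha> = w \<beta>" for \<alpha> \<beta>
  proof
    fix j
    show "\<alpha> j = \<beta> j"
    proof (cases "j \<le> n")
      case True
      then show ?thesis
        using that less Q
        by (intro digits_unique[of "Suc n" \<alpha> Q \<beta> j])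
          (auto simp: w_def lessThan_Suc_atMost less_Suc_eq_le intro: order.strict_trans2)
    next
      case False
      then show ?thesis
        using that by (auto simp: S_def PiE_def extensional_def)
    qed
  qed
  obtain \<alpha>0 where \<alpha>0: "\<alpha>0 \<in> S" "c \<alpha>0 \<noteq> 0"
    using c by (auto simp: S_def)
  have "Q > 0" using less[OF \<alpha>0(1), of 0] Q by simp
  \<comment> \<open>The exponents \<open>w \<alpha>\<close> are distinct, so nothing cancels in this
    coefficient.\<close>
  have "coeff R (w \<alpha>0) = (\<Sum>\<alpha>\<in>S. if \<alpha> = \<alpha>0 then c \<alpha> else 0)"
    unfolding R_def coeff_sum coeff_monom by (intro sum.cong) (use w_inj \<alpha>0 in auto)
  then have "R \<noteq> 0" using \<alpha>0 fin by auto
  moreover have "degree R \<le> Suc n * B * Q ^ n"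
    unfolding R_def
  proof (intro degree_sum_le[OF fin])
    fix \<alpha> assume "\<alpha> \<in> S"
    have "w \<alpha> \<le> (\<Sum>j\<le>n. B * Q ^ n)"
      unfolding w_def using less[OF \<open>\<alpha> \<in> S\<close>] \<open>Q > 0\<close>
      by (intro sum_mono mult_mono power_increasing) (auto simp: less_imp_le)
    then show "degree (monom (c \<alpha>) (w \<alpha>)) \<le> Suc n * B * Q ^ n"
      using degree_monom_le[of "c \<alpha>" "w \<alpha>"] by (simp add: algebra_simps)
  qed
  moreover have "poly_at R u \<in> I"
  proof -
    have "poly_at R u = (\<Sum>\<alpha>\<in>S. Const (c \<alpha>) * (\<Prod>j\<le>n. (u ^ (Q ^ j)) ^ \<alpha> j))"
      by (rule mpoly_eqI[OF inf])
        (simp add: R_def w_def poly_sum poly_monom mpoly_eval_sum mpoly_eval_mult mpoly_eval_prod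
          mpoly_eval_power power_sum mult.commute flip: power_mult)
    moreover have "(\<Sum>\<alpha>\<in>S. Const (c \<alpha>) * (\<Prod>j\<le>n. g j ^ \<alpha> j)) -
        (\<Sum>\<alpha>\<in>S. Const (c \<alpha>) * (\<Prod>j\<le>n. (u ^ (Q ^ j)) ^ \<alpha> j)) \<in> I"
      by (intro ideal_cong_sum[OF I] ideal_cong_mult[OF I] ideal_cong_prod[OF I]
          ideal_cong_power[OF I] g)
        (use I in \<open>auto simp: ring_ideal.subspace_0\<close>)
    ultimately have "- poly_at R u \<in> I"
      using rel by (simp add: S_def)
    then show ?thesis
      using ring_ideal.subspace_neg[OF I] by fastforce
  qed
  ultimately show ?thesis by blast
qed

section \<open>Frobenius\<close>

text \<open>Otherwise the product of all \<open>x - a\<close>, increased by 1, would be a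
  nonconstant polynomial without roots.\<close>

lemma infinite_UNIV_alg_closed: "infinite (UNIV :: 'k::alg_closed_field set)"
proof
  assume fin: "finite (UNIV :: 'k set)"
  define P :: "'k poly" where "P = (\<Prod>a\<in>UNIV. [:- a, 1:])"
  have "degree P = CARD('k)"
    unfolding P_def by (subst degree_prod_eq_sum_degree) auto
  then have "degree (P + 1) = CARD('k)"
    using fin by (subst degree_add_eq_left) (auto simp: finite_UNIV_card_ge_0)
  then obtain a where "poly (P + 1) a = 0"
    using alg_closed_imp_poly_has_root[of "P + 1"] fin by (auto simp: finite_UNIV_card_ge_0)
  moreover have "poly P a = 0"
    using fin by (auto simp: P_def poly_prod intro!: prod_zero)
  ultimately show False by simp
qed

text \<open>Multiplication by \<open>x \<noteq> 0\<close> permutes the nonzero elements; compare the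
  products over them.\<close>

lemma finite_field_power_card: "(x :: 'k::{field,finite}) ^ CARD('k) = x"
proof (cases "x = 0")
  case False
  let ?U = "UNIV - {0 :: 'k}"
  have "bij_betw ((*) x) ?U ?U"
    by (rule bij_betwI[where g = "(*) (inverse x)"]) (use False in auto)
  then have "(\<Prod>y\<in>?U. y) = (\<Prod>y\<in>?U. x * y)"
    by (rule prod.reindex_bij_betw[symmetric])
  also have "\<dots> = x ^ (CARD('k) - 1) * (\<Prod>y\<in>?U. y)"
    by (simp add: prod.distrib card_Diff_singleton)
  finally have "x ^ (CARD('k) - 1) = 1"
    by simp
  then have "x ^ Suc (CARD('k) - 1) = x"
    by (simp only: power_Suc mult_1_right)
  then show ?thesis by simp
qed simp

text \<open>Both sides are polynomials in \<open>x\<close>, and their difference has degree less than \<open>card S\<close>.\<close>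
lemma power_card_add_extend:
  fixes c x :: "'a::field"
  assumes S: "finite S" "S \<noteq> {}"
    and add: "\<And>d. d \<in> S \<Longrightarrow> (d + c) ^ card S = d ^ card S + c ^ card S"
  shows "(x + c) ^ card S = x ^ card S + c ^ card S"
proof -
  let ?q = "card S"
  define P where "P = [:c, 1:] ^ ?q - monom 1 ?q - [:c ^ ?q:]"
  have q: "?q > 0" using S by (simp add: card_gt_0_iff)
  have P: "poly P x = (x + c) ^ ?q - x ^ ?q - c ^ ?q" for x
    by (simp add: P_def poly_monom add.commute)
  have "P = 0"
  proof (rule ccontr)
    assume "P \<noteq> 0"
    have "S \<subseteq> {x. poly P x = 0}"
      using add by (auto simp: P)
    then have "?q \<le> card {x. poly P x = 0}"
      using poly_roots_finite[OF \<open>P \<noteq> 0\<close>] by (intro card_mono)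
    also have "\<dots> \<le> degree P"
      using \<open>P \<noteq> 0\<close> by (rule card_poly_roots_bound)
    finally have "?q \<le> degree P" .
    moreover have "degree P \<le> ?q"
      unfolding P_def using degree_monom_le[of "1::'a" ?q]
      by (intro degree_diff_le) (auto simp: degree_linear_power)
    moreover have "coeff P ?q = 0"
      using q by (simp add: P_def coeff_linear_power coeff_pCons split: nat.splits)
    ultimately show False
      using \<open>P \<noteq> 0\<close> by (metis le_antisym leading_coeff_0_iff)
  qed
  then show ?thesis using P[of x] by (simp add: algebra_simps)
qed

text \<open>On the finite field itself additivity is clear, its elements being fixed.
  \<open>power_card_add_extend\<close> frees first one summand, then the other, with no appeal to
  the characteristic.\<close>

lemma frobenius_add:
  fixes x y :: "'k::{field,finite} alg_closure"
  shows "(x + y) ^ (CARD('k) ^ m) = x ^ (CARD('k) ^ m) + y ^ (CARD('k) ^ m)"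
proof (induction m)
  case (Suc m)
  define S where "S = range (to_ac :: 'k \<Rightarrow> _)"
  have S: "finite S" "S \<noteq> {}" and card: "card S = CARD('k)"
    by (auto simp: S_def card_image inj_to_ac)
  have fixed: "d ^ CARD('k) = d" if "d \<in> S" for d
    using that by (auto simp: S_def finite_field_power_card simp flip: to_ac_power)
  have closed: "d + e \<in> S" if "d \<in> S" "e \<in> S" for d e
    using that by (auto simp: S_def simp flip: to_ac_add)
  have "(z + e) ^ CARD('k) = z ^ CARD('k) + e ^ CARD('k)" if "e \<in> S" for z e
    using power_card_add_extend[OF S, of e z] that by (simp add: card fixed closed)
  then have "(e + z) ^ CARD('k) = e ^ CARD('k) + z ^ CARD('k)" if "e \<in> S" for z e
    using that by (simp add: add.commute)
  then have "(z + z') ^ CARD('k) = z ^ CARD('k) + z' ^ CARD('k)" for z z' :: "'k alg_closure"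
    using power_card_add_extend[OF S, of z' z] by (simp add: card)
  then show ?case
    by (simp add: Suc.IH power_mult mult.commute[of "CARD('k)"])
qed simp

lemma frobenius_inj:
  fixes x y :: "'k::{field,finite} alg_closure"
  assumes "x ^ (CARD('k) ^ m) = y ^ (CARD('k) ^ m)"
  shows "x = y"
proof -
  have "(x - y) ^ (CARD('k) ^ m) + y ^ (CARD('k) ^ m) = x ^ (CARD('k) ^ m)"
    by (subst frobenius_add[symmetric]) simp
  then show ?thesis using assms by simp
qed

lemma frobenius_sum:
  fixes h :: "'a \<Rightarrow> 'k::{field,finite} alg_closure"
  shows "(\<Sum>x\<in>A. h x) ^ (CARD('k) ^ m) = (\<Sum>x\<in>A. h x ^ (CARD('k) ^ m))"
  by (induction A rule: infinite_finite_induct) (auto simp: frobenius_add)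

lemma mpoly_eval_frobenius:
  fixes p :: "('n::finite, 'k::{field,finite} alg_closure) mpoly"
  assumes "\<And>m. Poly_Mapping.lookup p m ^ (CARD('k) ^ s) = Poly_Mapping.lookup p m"
  shows "mpoly_eval p (\<chi> i. a $ i ^ (CARD('k) ^ s)) = mpoly_eval p a ^ (CARD('k) ^ s)"
  by (simp add: mpoly_eval_def frobenius_sum power_mult_distrib assms prod_power_distrib
      mult.commute flip: power_mult)

lemma frobenius_fixed_mult:
  fixes x :: "'k::{field,finite} alg_closure"
  assumes "x ^ (CARD('k) ^ s) = x"
  shows "x ^ (CARD('k) ^ (s * k)) = x"
  by (induction k) (simp_all add: power_add power_mult assms)

text \<open>All \<open>x ^ (q ^ m)\<close> are roots of one nonzero polynomial over the finite
  field, so two of them coincide; injectivity of Frobenius cancels the smaller exponent.\<close>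

lemma ex_frobenius_fixed:
  fixes x :: "'k::{field,finite} alg_closure"
  shows "\<exists>s>0. x ^ (CARD('k) ^ s) = x"
proof -
  obtain p :: "'k poly" where p: "p \<noteq> 0" "poly (map_poly to_ac p) x = 0"
    using alg_closure_algebraic .
  let ?p = "map_poly to_ac p"
  have coeff_fixed: "coeff ?p k ^ (CARD('k) ^ m) = coeff ?p k" for k m
  proof (induction m)
    case (Suc m)
    then show ?case
      by (simp add: power_mult coeff_map_poly finite_field_power_card flip: to_ac_power)
  qed simp
  have root: "poly ?p (x ^ (CARD('k) ^ m)) = 0" for m
  proof -
    have "poly ?p (x ^ (CARD('k) ^ m)) = poly ?p x ^ (CARD('k) ^ m)"
      by (simp add: poly_altdef frobenius_sum power_mult_distrib coeff_fixed mult.commute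
          flip: power_mult)
    then show ?thesis using p by simp
  qed
  have "?p \<noteq> 0" using p(1) by (simp add: map_poly_eq_0_iff)
  then have "finite (range (\<lambda>m. x ^ (CARD('k) ^ m)))"
    using root by (intro finite_subset[OF _ poly_roots_finite]) auto
  then have "\<not> inj (\<lambda>m :: nat. x ^ (CARD('k) ^ m))"
    using finite_imageD infinite_UNIV_nat by blast
  then obtain a b :: nat where ab: "a < b" "x ^ (CARD('k) ^ a) = x ^ (CARD('k) ^ b)"
    using linorder_injI[of "\<lambda>m :: nat. x ^ (CARD('k) ^ m)"] by blast
  then have "(x ^ (CARD('k) ^ (b - a))) ^ (CARD('k) ^ a) = x ^ (CARD('k) ^ a)"
    by (simp flip: power_mult power_add)
  then have "x ^ (CARD('k) ^ (b - a)) = x"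
    by (rule frobenius_inj)
  then show ?thesis using ab by (intro exI[of _ "b - a"]) simp
qed

lemma ex_frobenius_fixed_finite:
  fixes A :: "'k::{field,finite} alg_closure set"
  assumes "finite A"
  shows "\<exists>s>0. \<forall>x\<in>A. x ^ (CARD('k) ^ s) = x"
  using assms
proof (induction A rule: finite_induct)
  case (insert x A)
  obtain s t where "s > 0" "\<forall>x\<in>A. x ^ (CARD('k) ^ s) = x" "t > 0" "x ^ (CARD('k) ^ t) = x"
    using insert.IH ex_frobenius_fixed by blast
  then show ?case
    using frobenius_fixed_mult[of _ s t] frobenius_fixed_mult[of x t s]
    by (intro exI[of _ "s * t"]) (auto simp: mult.commute)
qed auto

section \<open>Iterates\<close>

text \<open>The polynomial \<open>u\<close> composed with the \<open>j\<close>-th iterate of the map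
  \<open>F\<close>; each new copy of \<open>F\<close> is applied first.\<close>

primrec subst_iterate ::
    "('n::finite \<Rightarrow> ('n, 'k::comm_ring_1) mpoly) \<Rightarrow> ('n, 'k) mpoly \<Rightarrow> nat \<Rightarrow> ('n, 'k) mpoly" where
  "subst_iterate F u 0 = u"
| "subst_iterate F u (Suc j) = mpoly_subst (subst_iterate F u j) F"

lemma mpoly_eval_subst_iterate:
  "mpoly_eval (subst_iterate F u j) a = mpoly_eval u (((\<lambda>a. \<chi> i. mpoly_eval (F i) a) ^^ j) a)"
  by (induction j arbitrary: a) (simp_all add: mpoly_eval_subst funpow_Suc_right del: funpow.simps(2))

text \<open>Substituting \<open>F\<close> is congruent to substituting the
  \<open>x\<^sub>i ^ Q\<close>, which raises \<open>?g j\<close> to the power \<open>Q\<close>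
  because \<open>F\<close> and \<open>u\<close> commute with that power map.\<close>

lemma subst_iterate_cong_power:
  fixes F :: "'n::finite \<Rightarrow> ('n, 'k::field) mpoly"
  assumes I: "ring_ideal.subspace I" and inf: "infinite (UNIV :: 'k set)"
    and gen: "\<And>i. F i - Var i ^ Q \<in> I"
    and F: "\<And>i a. mpoly_eval (F i) (\<chi> j. a $ j ^ Q) = mpoly_eval (F i) a ^ Q"
    and u: "\<And>a. mpoly_eval u (\<chi> j. a $ j ^ Q) = mpoly_eval u a ^ Q"
  shows "subst_iterate F u j - u ^ (Q ^ j) \<in> I"
proof (induction j)
  case 0
  then show ?case using I by (simp add: ring_ideal.subspace_0)
next
  case (Suc j)
  let ?g = "subst_iterate F u"
  have "mpoly_eval (?g j) (\<chi> i. a $ i ^ Q) = mpoly_eval (?g j) a ^ Q" for a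
  proof (induction j arbitrary: a)
    case (Suc j)
    then show ?case
      using Suc.IH[of "\<chi> i. mpoly_eval (F i) a"] by (simp add: mpoly_eval_subst F)
  qed (simp add: u)
  then have "mpoly_subst (?g j) (\<lambda>i. Var i ^ Q) = ?g j ^ Q"
    by (intro mpoly_eqI[OF inf]) (simp add: mpoly_eval_subst mpoly_eval_power)
  then have "?g (Suc j) - ?g j ^ Q \<in> I"
    using ideal_cong_subst[OF I, of F "\<lambda>i. Var i ^ Q" "?g j"] gen by simp
  moreover have "?g j ^ Q - (u ^ (Q ^ j)) ^ Q \<in> I"
    using Suc.IH by (rule ideal_cong_power[OF I])
  ultimately have "?g (Suc j) - ?g j ^ Q + (?g j ^ Q - (u ^ (Q ^ j)) ^ Q) \<in> I"
    by (rule ring_ideal.subspace_add[OF I])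
  then show ?case
    by (simp add: mult.commute flip: power_mult)
qed

text \<open>Otherwise, for large \<open>Q\<close>, a fixed power of the composite \<open>E\<close>
  would be a nonzero element of the ideal of degree below \<open>Q\<close>.\<close>

lemma vanishes_on_iterate:
  fixes F :: "'n::finite \<Rightarrow> ('n, 'k::{field,finite} alg_closure) mpoly"
  assumes F: "\<And>i m a. mpoly_eval (F i) (\<chi> j. a $ j ^ (CARD('k) ^ m)) = mpoly_eval (F i) a ^ (CARD('k) ^ m)"
    and D: "\<And>m a. m > 0 \<Longrightarrow> (\<And>i. mpoly_eval (F i) a = a $ i ^ (CARD('k) ^ m)) \<Longrightarrow> mpoly_eval D a = 0"
  shows "mpoly_eval D (((\<lambda>a. \<chi> i. mpoly_eval (F i) a) ^^ CARD('n)) a) = 0"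
proof (rule ccontr)
  let ?n = "CARD('n)" and ?q = "CARD('k)"
  let ?g = "subst_iterate F"
  define E where "E = ?g D ?n"
  assume "mpoly_eval D (((\<lambda>a. \<chi> i. mpoly_eval (F i) a) ^^ ?n) a) \<noteq> 0"
  then have E: "mpoly_eval E a \<noteq> 0"
    by (simp add: E_def mpoly_eval_subst_iterate)
  have inf: "infinite (UNIV :: 'k alg_closure set)"
    by (rule infinite_UNIV_alg_closed)
  obtain s where s: "s > 0" "\<And>m. Poly_Mapping.lookup D m ^ (?q ^ s) = Poly_Mapping.lookup D m"
  proof -
    \<comment> \<open>0 is included to cover the monomials outside the support of
      \<open>D\<close>.\<close>
    obtain s where s: "s > 0" "\<forall>c \<in> insert 0 (Poly_Mapping.lookup D ` Poly_Mapping.keys D). c ^ (?q ^ s) = c"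
      using ex_frobenius_fixed_finite[of "insert 0 (Poly_Mapping.lookup D ` Poly_Mapping.keys D)"]
      by auto
    have "Poly_Mapping.lookup D m ^ (?q ^ s) = Poly_Mapping.lookup D m" for m
      using s(2) by (cases "Poly_Mapping.lookup D m = 0") (simp_all add: in_keys_iff)
    with s(1) show thesis by (rule that)
  qed
  define rel where "rel u B c \<longleftrightarrow> (\<exists>\<alpha>\<in>PiE {..?n} (\<lambda>_. {..<B}). c \<alpha> \<noteq> 0) \<and>
    (\<Sum>\<alpha>\<in>PiE {..?n} (\<lambda>_. {..<B}). Const (c \<alpha>) * (\<Prod>j\<le>?n. ?g u j ^ \<alpha> j)) = 0" for u B c
  have "\<exists>B c. rel u B c" for u
    by (rule algebraic_dependence[of "?g u"]) (auto simp: rel_def)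
  \<comment> \<open>The relations are fixed before \<open>Q\<close>, which can therefore be taken
    large compared with them.\<close>
  then obtain B c where rel: "\<And>u. rel u (B u) (c u)"
    by metis
  obtain dF where dF: "\<And>i. degree_le dF (F i)"
    using ex_degree_le[of UNIV F] by auto
  obtain dE where dE: "degree_le dE E"
    using ex_degree_le[of "{()}" "\<lambda>_. E"] by auto
  define K where "K = Suc ?n * B D"
  define m where "m = Suc (dF + K * dE + B D + (\<Sum>i\<in>UNIV. B (Var i)))"
  \<comment> \<open>The factor \<open>s\<close> keeps the coefficients of \<open>D\<close> fixed by
    the \<open>Q\<close>-th power; the factor \<open>m\<close> makes \<open>Q\<close> exceed all
    bounds collected in \<open>m\<close>.\<close>
  define Q where "Q = ?q ^ (s * m)"
  have "card {0, 1 :: 'k} \<le> ?q"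
    by (rule card_mono) auto
  then have "?q \<ge> 2" by simp
  have "m \<le> s * m" using s by simp
  also have "\<dots> < 2 ^ (s * m)" by (rule less_exp)
  also have "\<dots> \<le> Q"
    unfolding Q_def using \<open>?q \<ge> 2\<close> by (rule power_mono) simp
  finally have "m < Q" .
  have "B (Var i) \<le> (\<Sum>i\<in>UNIV. B (Var i))" for i
    by (rule member_le_sum) auto
  then have Q: "dF < Q" "K * dE < Q" "B D \<le> Q" "B (Var i) \<le> Q" for i
    using \<open>m < Q\<close> by (auto simp: m_def intro: order.trans[of _ "\<Sum>i\<in>UNIV. B (Var i)"])
  define I where "I = ring_ideal.span (range (\<lambda>i. F i - Var i ^ Q))"
  have I: "ring_ideal.subspace I"
    by (simp add: I_def ring_ideal.subspace_span)
  have gen: "F i - Var i ^ Q \<in> I" for i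
    unfolding I_def by (rule ring_ideal.span_base) simp
  have F_Q: "mpoly_eval (F i) (\<chi> j. a $ j ^ Q) = mpoly_eval (F i) a ^ Q" for i a
    unfolding Q_def by (rule F)
  have D_Q: "mpoly_eval D (\<chi> j. a $ j ^ Q) = mpoly_eval D a ^ Q" for a
    unfolding Q_def using s(2) by (intro mpoly_eval_frobenius frobenius_fixed_mult)
  have annih: "\<exists>R. R \<noteq> 0 \<and> Polynomial.degree R \<le> Suc ?n * B u * Q ^ ?n \<and> poly_at R u \<in> I"
    if "\<And>a. mpoly_eval u (\<chi> j. a $ j ^ Q) = mpoly_eval u a ^ Q" "B u \<le> Q" for u
    using subst_iterate_cong_power[OF I inf gen F_Q that(1)] rel[of u] that(2) unfolding rel_def
    by (intro ex_annihilating_poly[OF I inf, of ?n "?g u" u Q "B u" "c u"]) auto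
  \<comment> \<open>The relation for \<open>u = x\<^sub>i\<close> makes each variable satisfy a
    univariate equation modulo \<open>I\<close>, as the Nullstellensatz requires.\<close>
  have "\<exists>R. R \<noteq> 0 \<and> poly_at R (Var i) \<in> I" for i
    using annih[of "Var i"] Q(4) by auto
  moreover have "mpoly_eval D b = 0" if "\<forall>p\<in>I. mpoly_eval p b = 0" for b
  proof (rule D)
    show "s * m > 0" using s by (simp add: m_def)
    show "mpoly_eval (F i) b = b $ i ^ (?q ^ (s * m))" for i
      using that gen[of i] by (force simp: mpoly_eval_diff mpoly_eval_power Q_def)
  qed
  ultimately obtain N where N: "D ^ N \<in> I"
    using zero_dim_nullstellensatz[OF I inf] by blast
  obtain R where R: "R \<noteq> 0" "Polynomial.degree R \<le> K * Q ^ ?n" "poly_at R D \<in> I"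
    using annih[of D] D_Q Q(3) by (auto simp: K_def)
  have "D ^ Polynomial.degree R \<in> I"
    using poly_at_nilpotent[OF I N R(1,3)] .
  \<comment> \<open>Pads the exponent to \<open>K * Q ^ ?n\<close>, where the power of
    \<open>D\<close> is congruent to \<open>E ^ K\<close>.\<close>
  then have "D ^ (K * Q ^ ?n - Polynomial.degree R) * D ^ Polynomial.degree R \<in> I"
    using I by (simp add: ring_ideal.subspace_def)
  then have "(D ^ (Q ^ ?n)) ^ K \<in> I"
    using R(2) by (simp add: mult.commute flip: power_mult power_add)
  moreover have "E ^ K - (D ^ (Q ^ ?n)) ^ K \<in> I"
    unfolding E_def by (intro ideal_cong_power[OF I] subst_iterate_cong_power[OF I inf gen F_Q D_Q])
  ultimately have "E ^ K \<in> I"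
    using ring_ideal.subspace_add[OF I] by fastforce
  \<comment> \<open>The degree of \<open>E ^ K\<close> is at most \<open>K * dE\<close>, which does
    not grow with \<open>Q\<close>.\<close>
  then have "E ^ K = 0"
    unfolding I_def
  proof (rule low_degree_in_ideal_eq_0[rotated])
    show "mdegree m < Q" if "m \<in> Poly_Mapping.keys (F i)" for m i
      using dF[of i] that Q(1) by (auto simp: degree_le_def)
    show "mdegree m < Q" if "m \<in> Poly_Mapping.keys (E ^ K)" for m
      using degree_le_power[OF dE, of K] that Q(2) by (auto simp: degree_le_def)
  qed
  then have "mpoly_eval E a ^ K = 0"
    by (simp flip: mpoly_eval_power)
  then show False using E by simp
qed

section \<open>Quasi-fixed points and their density\<close>

lemma poly_self_map_frobenius:
  fixes f :: "'n::finite \<Rightarrow> ('n, 'k::{field,finite}) mpoly"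
  shows "mpoly_eval (Poly_Mapping.map to_ac (f i)) (\<chi> j. a $ j ^ (CARD('k) ^ m)) =
    mpoly_eval (Poly_Mapping.map to_ac (f i)) a ^ (CARD('k) ^ m)"
proof (rule mpoly_eval_frobenius)
  have "c ^ (CARD('k) ^ m) = c" for c :: 'k
    by (induction m) (simp_all add: power_mult finite_field_power_card)
  then show "Poly_Mapping.lookup (Poly_Mapping.map to_ac (f i)) l ^ (CARD('k) ^ m) =
      Poly_Mapping.lookup (Poly_Mapping.map to_ac (f i)) l" for l
    by (simp add: map.rep_eq when_def flip: to_ac_power)
qed

text \<open>
  On the orbit of a quasi-fixed point the map acts as a power of Frobenius, so the point is
  periodic.
\<close>
lemma quasi_fixed_in_range_iterate:
  fixes f :: "'n::finite \<Rightarrow> ('n, 'k::{field,finite}) mpoly"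
  assumes "quasi_fixed f a"
  shows "a \<in> range (poly_self_map f ^^ n)"
proof -
  let ?q = "CARD('k)"
  obtain m where m: "\<And>i. poly_self_map f a $ i = a $ i ^ (?q ^ m)"
    using assms by (auto simp: quasi_fixed_def)
  have iter: "(poly_self_map f ^^ j) a = (\<chi> i. a $ i ^ (?q ^ (m * j)))" for j
  proof (induction j)
    case (Suc j)
    have "(poly_self_map f ^^ Suc j) a = poly_self_map f (\<chi> i. a $ i ^ (?q ^ (m * j)))"
      by (simp add: Suc.IH)
    also have "\<dots> = (\<chi> i. (poly_self_map f a $ i) ^ (?q ^ (m * j)))"
      by (simp add: poly_self_map_def poly_self_map_frobenius)
    also have "\<dots> = (\<chi> i. a $ i ^ (?q ^ (m * Suc j)))"
      by (simp add: m power_add flip: power_mult)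
    finally show ?case .
  qed (simp add: vec_eq_iff)
  obtain s where s: "s > 0" "\<And>i. a $ i ^ (?q ^ s) = a $ i"
    using ex_frobenius_fixed_finite[of "range (\<lambda>i. a $ i)"] by auto
  have "(poly_self_map f ^^ (n * s)) a = a"
    using frobenius_fixed_mult[OF s(2), of _ "m * n"] by (simp add: iter vec_eq_iff mult_ac)
  \<comment> \<open>Since \<open>s > 0\<close>, a full period contains \<open>n\<close> iterations
    to split off.\<close>
  moreover have "n * s = n + n * (s - 1)"
    using s(1) by (cases s) simp_all
  ultimately have "a = (poly_self_map f ^^ n) ((poly_self_map f ^^ (n * (s - 1))) a)"
    by (metis comp_apply funpow_add)
  then show ?thesis by blast
qed

theorem theorem1p4:
  fixes f :: "'n::finite \<Rightarrow> ('n, 'k::{field,finite}) mpoly"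
    and V :: "('k alg_closure ^ 'n) set"
  defines "V \<equiv> zariski closure_of range (poly_self_map f ^^ CARD('n))"
  shows "(\<forall>a. quasi_fixed f a \<longrightarrow> a \<in> V) \<and>
    subtopology zariski V closure_of {a. quasi_fixed f a} = V \<and>
    (\<forall>W. closedin zariski W \<and> W \<subset> V \<longrightarrow>
       (\<exists>m>0. \<exists>a\<in>V - W. \<forall>i. poly_self_map f a $ i = (a $ i) ^ (CARD('k) ^ m)))"
proof -
  let ?F = "\<lambda>i. Poly_Mapping.map to_ac (f i)" and ?X = "{a. quasi_fixed f a}"
  have self_map: "poly_self_map f = (\<lambda>a. \<chi> i. mpoly_eval (?F i) a)"
    by (simp add: poly_self_map_def fun_eq_iff)
  have in_V: "?X \<subseteq> V"
    using quasi_fixed_in_range_iterate[of f] closure_of_subset[of _ zariski]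
    by (fastforce simp: V_def)
  have dense: "V \<subseteq> W" if W: "closedin zariski W" "?X \<subseteq> W" for W
    unfolding V_def
  proof (rule closure_of_minimal)
    obtain S where S: "W = zero_locus S"
      using W(1) by (auto simp: closedin_zariski)
    \<comment> \<open>Each equation of \<open>W\<close> holds at the quasi-fixed points, hence on
      the image of the iterate.\<close>
    have "mpoly_eval p ((poly_self_map f ^^ CARD('n)) a) = 0" if "p \<in> S" for p a
      unfolding self_map
    proof (rule vanishes_on_iterate[OF poly_self_map_frobenius])
      fix m b assume "m > 0" "\<And>i. mpoly_eval (?F i) b = b $ i ^ (CARD('k) ^ m)"
      then have "b \<in> ?X"
        by (auto simp: quasi_fixed_def poly_self_map_def)
      then show "mpoly_eval p b = 0"
        using W(2) that by (auto simp: S zero_locus_def)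
    qed
    then show "range (poly_self_map f ^^ CARD('n)) \<subseteq> W"
      by (auto simp: S zero_locus_def)
  qed (fact W(1))
  have "V \<subseteq> zariski closure_of ?X"
    by (rule dense) (simp_all add: closure_of_subset)
  then have "subtopology zariski V closure_of ?X = V"
    using in_V by (simp add: closure_of_subtopology Int_absorb1 Int_absorb2)
  \<comment> \<open>Otherwise \<open>W\<close> would contain all quasi-fixed points, hence
    \<open>V\<close>.\<close>
  moreover have "\<exists>m>0. \<exists>a\<in>V - W. \<forall>i. poly_self_map f a $ i = (a $ i) ^ (CARD('k) ^ m)"
    if "closedin zariski W" "W \<subset> V" for W
    using dense[of W] in_V that unfolding quasi_fixed_def by blast
  ultimately show ?thesis
    using in_V by blast
qed

end
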